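(* For each integer $k\ge 1$, every oriented graph $D$ with more than $(3k-4)|V(D)|/2$ edges contains each antidirected path of length $k$ (as a subgraph).
   Context: All digraphs are finite. A digraph has directed edges, at most one for each direction between each pair of distinct vertices (no loops); $uv$ denotes an edge from $u$ to $v$. An oriented graph is a digraph in which for each pair of vertices $u,v$ at most one of the edges $uv$, $vu$ is present. $V(D)$ denotes the vertex set of $D$. An antidirected path (antipath) is an orientation of a path in which every vertex has, within the path, either out-degree $0$ or in-degree $0$; that is, edge directions alternate along the path. Its length is its number of edges. Up to isomorphism there is exactly one antidirected path of length $k$ if $k$ is odd, and there are exactly two if $k\ge 2$ is even (both end-edges directed away from the endvertices, or both directed towards the endvertices); "each antidirected path of length $k$" means all of these.
   Formalization: For k = 1 it is additionally assumed that D has at least one edge: there the bound is −|V(D)|/2, so any nonempty edgeless D meets the hypothesis but contains no path of length 1; for k ≥ 2 the statement is unchanged. *)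

theory Defs
  imports Complex_Main "Graph_Theory.Graph_Theory"
begin

locale oriented_graph = pair_digraph +
  assumes no_antiparallel_arcs: "(u, v) \<in> parcs G \<Longrightarrow> (v, u) \<notin> parcs G"

text \<open>
  An orientation of a path with vertices \<open>p ! 0, \<dots>, p ! k\<close> is an oriented graph on these
  (distinct) vertices whose symmetric closure is the path, viewed as a symmetric digraph.
  Degrees are taken within the path itself.
\<close>
definition antidirected_path :: "nat \<Rightarrow> 'a pair_pre_digraph \<Rightarrow> bool" where
  "antidirected_path k P \<longleftrightarrow>
     oriented_graph P \<and>
     (\<exists>p. distinct p \<and> length p = k + 1 \<and> pverts P = set p \<and>
          parcs (mk_symmetric (with_proj P)) =
            (\<Union>i<k. {(p ! i, p ! (i + 1)), (p ! (i + 1), p ! i)})) \<and>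
     (\<forall>v\<in>pverts P. out_degree (with_proj P) v = 0 \<or> in_degree (with_proj P) v = 0)"

text \<open>Containment as a (not necessarily induced) subgraph, up to isomorphism.\<close>
definition contains_copy :: "'a pair_pre_digraph \<Rightarrow> 'b pair_pre_digraph \<Rightarrow> bool" where
  "contains_copy D P \<longleftrightarrow>
     (\<exists>H :: 'a pair_pre_digraph.
        subgraph (with_proj H) (with_proj D) \<and> digraph_iso (with_proj P) (with_proj H))"

end

theory Submission
  imports Defs
begin

text \<open>
  Antidirected paths are paths in the bipartite split graph on \<open>V \<times> bool\<close>, in which \<open>(u, True)\<close>
  and \<open>(v, False)\<close> are adjacent iff \<open>uv\<close> is an arc, that do not visit both copies of a vertex.
  For \<open>k \<ge> 3\<close> the edge bound yields a set of arcs in which all positive in- and out-degrees are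
  at least some \<open>d \<ge> 2\<close> with \<open>4d \<ge> 3k - 3\<close>, and paths are lengthened one vertex at a time.

  Suppose that a path on \<open>k\<close> vertices cannot be extended. Let \<open>X\<close> be the vertices of the type of
  its last vertex and \<open>Y\<close> the others. Fix the start and let \<open>S \<subseteq> X\<close> be the set of ends of paths on
  the same typed vertices. All neighbours of \<open>x \<in> S\<close> are in \<open>X \<union> Y\<close>, at most \<open>|S|\<close> of them
  in \<open>Y\<close>, because Posa rotations at distinct neighbours give distinct ends. As the graph is
  oriented, \<open>S\<close> spans at most \<open>|S| (|S| - 1) / 2\<close> arcs. Counting gives \<open>S = X\<close>, or \<open>X\<close>
  without the start if \<open>k\<close> is odd; reversing the path then makes the start an end too. Counting
  again shows that \<open>X\<close> and \<open>Y\<close> are completely joined. Finally \<open>d > |Y|\<close> forces an arc inside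
  \<open>X\<close>, and using its end \<open>x'\<close> in the opposite type gives an exit from \<open>X \<union> Y\<close> from which a
  longer path can be built.
\<close>

section \<open>Antipaths in the split graph\<close>

text \<open>The Boolean is the type of \<open>u\<close>: \<open>True\<close> for a tail,
  \<open>False\<close> for a head. Carrying it as a parameter lets one argument serve both
  directions.\<close>

definition nbrs :: "('a \<times> 'a) set \<Rightarrow> bool \<Rightarrow> 'a \<Rightarrow> 'a set" where
  "nbrs E b u = (if b then E `` {u} else E\<inverse> `` {u})"

definition split_adj :: "('a \<times> 'a) set \<Rightarrow> 'a \<times> bool \<Rightarrow> 'a \<times> bool \<Rightarrow> bool" where
  "split_adj E x y \<longleftrightarrow> snd y \<noteq> snd x \<and> fst y \<in> nbrs E (snd x) (fst x)"

definition antipath :: "('a \<times> 'a) set \<Rightarrow> ('a \<times> bool) list \<Rightarrow> bool" where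
  "antipath E p \<longleftrightarrow> p \<noteq> [] \<and> successively (split_adj E) p \<and> distinct (map fst p)"

definition layer :: "('a \<times> bool) list \<Rightarrow> bool \<Rightarrow> 'a set" where
  "layer p b = {u. (u, b) \<in> set p}"

definition ends :: "('a \<times> 'a) set \<Rightarrow> ('a \<times> bool) list \<Rightarrow> 'a set" where
  "ends E p = {u. \<exists>q. antipath E q \<and> set q = set p \<and> hd q = hd p \<and> last q = (u, snd (last p))}"

lemma nbrs_swap: "v \<in> nbrs E b u \<longleftrightarrow> u \<in> nbrs E (\<not> b) v"
  by (auto simp: nbrs_def)

lemma nbrs_flip: "v \<in> nbrs E (\<not> b) u \<longleftrightarrow> u \<in> nbrs E b v"
  by (auto simp: nbrs_def)

lemma split_adj_sym: "split_adj E x y \<longleftrightarrow> split_adj E y x"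
  unfolding split_adj_def using nbrs_swap[of "fst y" E "snd x" "fst x"]
  by (cases "snd x"; cases "snd y") auto

lemma split_adj_pair: "split_adj E (u, b) (v, c) \<longleftrightarrow> c = (\<not> b) \<and> v \<in> nbrs E b u"
  by (auto simp: split_adj_def)

lemma antipath_snoc:
  assumes "antipath E p" "split_adj E (last p) y" "fst y \<notin> fst ` set p"
  shows "antipath E (p @ [y])"
  using assms by (auto simp: antipath_def successively_append_iff)

lemma successively_split_adj_rev:
  "successively (split_adj E) (rev p) \<longleftrightarrow> successively (split_adj E) p"
proof -
  have "(\<lambda>x y. split_adj E y x) = split_adj E"
    by (intro ext) (rule split_adj_sym)
  then show ?thesis by (simp only: successively_rev)
qed

lemma antipath_rev: "antipath E p \<Longrightarrow> antipath E (rev p)"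
  by (simp add: antipath_def successively_split_adj_rev rev_map[symmetric] del: successively_rev)

lemma antipath_distinct: "antipath E p \<Longrightarrow> distinct p"
  by (auto simp: antipath_def distinct_map)

lemma antipath_last_type:
  assumes "antipath E p"
  shows "snd (last p) = (snd (hd p) = odd (length p))"
proof -
  have "p \<noteq> []" "successively (split_adj E) p"
    using assms by (auto simp: antipath_def)
  then show ?thesis
  proof (induction p rule: rev_nonempty_induct)
    case (single x)
    then show ?case by simp
  next
    case (snoc x xs)
    then show ?case
      by (auto simp: successively_append_iff split_adj_def)
  qed
qed

text \<open>Types alternate backwards from the last vertex, so its type receives the larger half
  when the length is odd.\<close>

lemma card_layer_last:
  assumes "antipath E p"
  shows "card (layer p (snd (last p))) = (length p + 1) div 2"
    and "card (layer p (\<not> snd (last p))) = length p div 2"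
proof -
  have *: "card (layer p b) = length (filter (\<lambda>x. snd x = b) p)" for b
  proof -
    have "layer p b = set (map fst (filter (\<lambda>x. snd x = b) p))"
      by (force simp: layer_def)
    moreover have "distinct (map fst (filter (\<lambda>x. snd x = b) p))"
      using assms by (simp add: antipath_def distinct_map_filter)
    ultimately show ?thesis
      by (metis distinct_card length_map)
  qed
  have "p \<noteq> []" "successively (split_adj E) p"
    using assms by (auto simp: antipath_def)
  then have "length (filter (\<lambda>x. snd x = snd (last p)) p) = (length p + 1) div 2 \<and>
    length (filter (\<lambda>x. snd x = (\<not> snd (last p))) p) = length p div 2"
  proof (induction p rule: rev_nonempty_induct)
    case (single x)
    then show ?case by simp
  next
    case (snoc x xs)
    then have "snd (last xs) = (\<not> snd x)"
      by (auto simp: successively_append_iff split_adj_def)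
    with snoc show ?case
      by (auto simp: successively_append_iff)
  qed
  with * show "card (layer p (snd (last p))) = (length p + 1) div 2"
    and "card (layer p (\<not> snd (last p))) = length p div 2"
    by simp_all
qed

lemma finite_layer: "finite (layer p b)"
proof -
  have "layer p b \<subseteq> fst ` set p" by (force simp: layer_def)
  then show ?thesis by (meson List.finite_set finite_imageI finite_subset)
qed

lemma fst_image_eq_layers: "fst ` set p = layer p b \<union> layer p (\<not> b)"
proof -
  have "(u \<in> fst ` set p) = (\<exists>c. (u, c) \<in> set p)" for u
    by (force simp: image_iff)
  then have "u \<in> fst ` set p \<longleftrightarrow> u \<in> layer p b \<union> layer p (\<not> b)" for u
    by (cases b) (auto simp: layer_def ex_bool_eq)
  then show ?thesis by blast
qed

lemma layers_disjoint:
  assumes "antipath E p"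
  shows "layer p b \<inter> layer p (\<not> b) = {}"
proof -
  have "inj_on fst (set p)" using assms by (auto simp: antipath_def distinct_map)
  then have "u \<notin> layer p (\<not> b)" if "u \<in> layer p b" for u
    using that inj_onD[of fst "set p" "(u, b)" "(u, \<not> b)"] by (auto simp: layer_def)
  then show ?thesis by blast
qed

section \<open>Rotations and path ends\<close>

lemma ends_subset: "antipath E p \<Longrightarrow> ends E p \<subseteq> layer p (snd (last p))"
  by (force simp: ends_def layer_def antipath_def dest: last_in_set)

text \<open>Posa rotation: the edge from \<open>q ! i\<close> to the last vertex replaces the edge
  from \<open>q ! i\<close> to its successor, and the tail is traversed backwards. The vertices are
  only permuted, so distinctness survives.\<close>

lemma antipath_rotate:
  assumes "antipath E q" "Suc i < length q" "split_adj E (q ! i) (last q)"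
  shows "antipath E (take (Suc i) q @ rev (drop (Suc i) q))"
proof -
  let ?xs = "take (Suc i) q" and ?ys = "drop (Suc i) q"
  have ne: "?xs \<noteq> []" "?ys \<noteq> []" using assms(2) by auto
  have q: "q = ?xs @ ?ys" by simp
  have s: "successively (split_adj E) ?xs" "successively (split_adj E) ?ys"
    using assms(1) by (metis antipath_def q successively_append_iff)+
  have "successively (split_adj E) (rev ?ys)"
    using s(2) by (simp add: successively_split_adj_rev del: successively_rev)
  moreover have "last ?xs = q ! i"
    using assms(2) by (simp add: take_Suc_conv_app_nth)
  moreover have "hd (rev ?ys) = last q"
    using assms(2) by (simp add: hd_rev)
  ultimately have "successively (split_adj E) (?xs @ rev ?ys)"
    using s(1) assms(3) by (simp add: successively_append_iff)
  moreover have "distinct (map fst (?xs @ rev ?ys))"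
  proof -
    have "mset (map fst (?xs @ rev ?ys)) = mset (map fst q)"
      by (metis mset_map mset_append mset_rev q)
    then show ?thesis using assms(1) by (metis antipath_def mset_eq_imp_distinct_iff)
  qed
  ultimately show ?thesis using ne by (simp add: antipath_def)
qed

text \<open>Rotating at the neighbour \<open>y\<close> of the last vertex makes the successor of \<open>y\<close> the last
  vertex, and different neighbours have different successors.\<close>

lemma card_nbrs_le_ends:
  assumes p: "antipath E p" and u: "u \<in> ends E p"
  shows "card (nbrs E (snd (last p)) u \<inter> layer p (\<not> snd (last p))) \<le> card (ends E p)"
proof -
  define e where "e = snd (last p)"
  obtain q where q: "antipath E q" "set q = set p" "hd q = hd p" "last q = (u, e)"
    using u by (auto simp: ends_def e_def)
  let ?M = "nbrs E e u \<inter> layer p (\<not> e)"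
  have "\<exists>i. Suc i < length q \<and> q ! i = (y, \<not> e) \<and> fst (q ! Suc i) \<in> ends E p" if y: "y \<in> ?M" for y
  proof -
    have "(y, \<not> e) \<in> set q" using y q by (auto simp: layer_def)
    then obtain i where i: "i < length q" "q ! i = (y, \<not> e)"
      by (metis in_set_conv_nth)
    \<comment> \<open>The last vertex has type \<open>e\<close> and \<open>y\<close> occurs with the
      other type, so \<open>y\<close> has a successor on the path.\<close>
    have "i \<noteq> length q - 1"
      using i q(4) by (metis Pair_inject antipath_def last_conv_nth q(1))
    then have i1: "Suc i < length q" using i by linarith
    let ?q = "take (Suc i) q @ rev (drop (Suc i) q)"
    have "split_adj E (q ! i) (last q)"
      using y i q nbrs_swap[of y E e u] by (simp add: split_adj_pair)
    then have 1: "antipath E ?q" using antipath_rotate q(1) i1 by blast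
    have 2: "set ?q = set p" using q(2) by (metis append_take_drop_id set_append set_rev)
    have 3: "hd ?q = hd p" using q(3) i1 by (metis Nat.lessE append_Nil2 append_take_drop_id hd_append2 length_0_conv list.size(3) not_less_zero take_Suc list.simps(3))
    have 4: "last ?q = q ! Suc i" using i1 by (simp add: last_rev hd_drop_conv_nth)
    have "split_adj E (q ! i) (q ! Suc i)"
      using q(1) i1 by (auto simp: antipath_def successively_conv_nth)
    then have "snd (q ! Suc i) = e" using i by (auto simp: split_adj_def)
    then have "fst (q ! Suc i) \<in> ends E p"
      unfolding ends_def e_def[symmetric] using 1 2 3 4
      by (intro CollectI exI[of _ ?q]) (simp add: prod_eq_iff)
    then show ?thesis using i i1 by blast
  qed
  then obtain g where g: "\<And>y. y \<in> ?M \<Longrightarrow> Suc (g y) < length q \<and> q ! g y = (y, \<not> e) \<and> fst (q ! Suc (g y)) \<in> ends E p"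
    by metis
  have inj: "inj_on (\<lambda>y. fst (q ! Suc (g y))) ?M"
  proof (rule inj_onI)
    fix y z assume yz: "y \<in> ?M" "z \<in> ?M" "fst (q ! Suc (g y)) = fst (q ! Suc (g z))"
    have "map fst q ! Suc (g y) = map fst q ! Suc (g z)" using g yz by simp
    moreover have "distinct (map fst q)" using q by (simp add: antipath_def)
    ultimately have "Suc (g y) = Suc (g z)"
      using g yz by (metis length_map nth_eq_iff_index_eq)
    then show "y = z" using g yz by (metis Pair_inject Suc_inject)
  qed
  have "finite (ends E p)" using finite_subset[OF ends_subset[OF p] finite_layer] .
  then have "card ?M \<le> card (ends E p)"
    using card_inj_on_le[OF inj] g by blast
  then show ?thesis by (simp add: e_def)
qed

section \<open>Counting arcs and assembling long paths\<close>

text \<open>The arcs inside \<open>S\<close>, their converses and the diagonal are pairwise disjoint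
  subsets of \<open>S \<times> S\<close>.\<close>

lemma asym_arc_count:
  fixes N :: "'a \<Rightarrow> 'a set"
  assumes fin: "finite S" and asym: "\<And>x y. y \<in> N x \<Longrightarrow> x \<notin> N y"
  shows "2 * (\<Sum>x\<in>S. card (N x \<inter> S)) + card S \<le> card S * card S"
proof -
  define T where "T = Sigma S (\<lambda>x. N x \<inter> S)"
  have fT: "finite T" using fin by (auto simp: T_def)
  have cT: "card T = (\<Sum>x\<in>S. card (N x \<inter> S))"
    unfolding T_def using fin by (subst card_SigmaI) auto
  have cI: "card (Id_on S) = card S"
  proof -
    have "Id_on S = (\<lambda>x. (x, x)) ` S" by auto
    then show ?thesis by (simp add: card_image inj_on_def)
  qed
  have "T \<inter> T\<inverse> = {}" "(T \<union> T\<inverse>) \<inter> Id_on S = {}" using asym by (auto simp: T_def)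
  moreover have "finite (Id_on S)" using fin by (simp add: Id_on_def)
  ultimately have "card (T \<union> T\<inverse> \<union> Id_on S) = card T + card T + card S"
    using fT cI by (simp add: card_Un_disjoint card_inverse)
  moreover have "card (T \<union> T\<inverse> \<union> Id_on S) \<le> card (S \<times> S)"
    by (rule card_mono) (use fin in \<open>auto simp: T_def\<close>)
  ultimately show ?thesis using cT by (simp add: card_cartesian_product)
qed

text \<open>Complete adjacency lets the path alternate greedily between \<open>Y\<close> and
  \<open>X\<close>, starting and finishing in \<open>Y\<close>. It uses all of \<open>X\<close> and
  one more vertex of \<open>Y\<close> than of \<open>X\<close>, hence the strict inequality.\<close>

lemma antipath_zigzag:
  assumes "antipath E p" "last p = (x, e)" "finite X" "finite Y" "card X < card Y"
    and "(X \<union> Y) \<inter> fst ` set p = {}" "X \<inter> Y = {}"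
    and "\<And>z. z \<in> insert x X \<Longrightarrow> Y \<subseteq> nbrs E e z"
  shows "\<exists>q. antipath E q \<and> hd q = hd p \<and> length q = length p + 2 * card X + 1"
  using assms
proof (induction "card X" arbitrary: p x X Y)
  case 0
  then have "Y \<noteq> {}" "X = {}" by auto
  then obtain y where y: "y \<in> Y" by blast
  then have "antipath E (p @ [(y, \<not> e)])"
    using 0 by (intro antipath_snoc) (auto simp: split_adj_pair)
  moreover have "hd (p @ [(y, \<not> e)]) = hd p" using 0 by (simp add: antipath_def)
  ultimately show ?case using \<open>X = {}\<close> by (intro exI[of _ "p @ [(y, \<not> e)]"]) auto
next
  case (Suc n)
  obtain x' where x': "x' \<in> X" using Suc by fastforce
  obtain y where y: "y \<in> Y" using Suc by fastforce
  have "y \<in> nbrs E e x" using Suc.prems(8) y by blast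
  then have a1: "antipath E (p @ [(y, \<not> e)])"
    using Suc.prems y by (intro antipath_snoc) (auto simp: split_adj_pair)
  have "y \<in> nbrs E e x'" using Suc.prems x' y by blast
  then have "split_adj E (y, \<not> e) (x', e)"
    using nbrs_swap[of y E e x'] by (simp add: split_adj_pair)
  then have a2: "antipath E ((p @ [(y, \<not> e)]) @ [(x', e)])"
    using Suc.prems y x' by (intro antipath_snoc[OF a1]) auto
  have nx: "n = card (X - {x'})" using Suc x' by simp
  have "card (Y - {y}) = card Y - 1" using Suc.prems(4) y by simp
  then have cY: "card (X - {x'}) < card (Y - {y})" using nx Suc by linarith
  have "\<exists>q. antipath E q \<and> hd q = hd ((p @ [(y, \<not> e)]) @ [(x', e)]) \<and>
     length q = length ((p @ [(y, \<not> e)]) @ [(x', e)]) + 2 * card (X - {x'}) + 1"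
  proof (rule Suc.hyps(1)[OF nx a2 _ _ _ cY])
    show "\<And>z. z \<in> insert x' (X - {x'}) \<Longrightarrow> Y - {y} \<subseteq> nbrs E e z"
      using Suc.prems(8) x' by blast
  qed (use Suc.prems x' y in auto)
  moreover have "hd ((p @ [(y, \<not> e)]) @ [(x', e)]) = hd p" using Suc.prems by (simp add: antipath_def)
  ultimately show ?case using nx Suc.hyps(2) by auto
qed

lemma arc_antipath:
  assumes "(u, v) \<in> E" "u \<noteq> v"
  shows "\<exists>p. antipath E p \<and> length p = 2 \<and> snd (hd p) = c"
  using assms
  by (intro exI[of _ "if c then [(u, True), (v, False)] else [(v, False), (u, True)]"])
    (auto simp: antipath_def split_adj_def nbrs_def)

section \<open>Extending paths under a minimum degree condition\<close>

text \<open>The bound concerns positive degrees only: after arcs have been deleted, a vertex may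
  have lost all its outgoing or all its incoming arcs.\<close>

locale dense_arcs =
  fixes E :: "('a \<times> 'a) set" and d :: nat
  assumes asym: "(u, v) \<in> E \<Longrightarrow> (v, u) \<notin> E"
    and min_degree: "v \<in> nbrs E b u \<Longrightarrow> d \<le> card (nbrs E b u)"
begin

lemma nbrs_asym: "v \<in> nbrs E b u \<Longrightarrow> u \<notin> nbrs E b v"
  by (auto simp: nbrs_def dest: asym split: if_splits)

text \<open>The predecessor on the path is a neighbour in the right direction, so the degree is
  positive and the minimum degree applies.\<close>

lemma last_degree:
  assumes "antipath E p" "2 \<le> length p"
  shows "d \<le> card (nbrs E (snd (last p)) (fst (last p)))"
proof -
  obtain n where n: "length p = Suc (Suc n)" using assms(2) by (metis Suc_le_D numeral_2_eq_2 Suc_le_mono)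
  have "split_adj E (p ! n) (p ! Suc n)"
    using assms n by (auto simp: antipath_def successively_conv_nth)
  moreover have "last p = p ! Suc n"
    using n by (metis One_nat_def diff_Suc_1 last_conv_nth list.size(3) nat.distinct(1))
  ultimately have "split_adj E (last p) (p ! n)" using split_adj_sym by metis
  then show ?thesis using min_degree by (auto simp: split_adj_def)
qed

text \<open>Degrees are summed over \<open>S\<close> and split into neighbours in \<open>Y\<close>,
  in \<open>X - S\<close> and in \<open>S\<close>; asymmetry bounds the last part. The other two
  sums stay open, since their bounds depend on the choice of \<open>S\<close>.\<close>

lemma degree_count:
  assumes "finite X" "finite Y" "X \<inter> Y = {}" "S \<subseteq> X"
    and nb: "\<And>x. x \<in> S \<Longrightarrow> nbrs E e x \<subseteq> X \<union> Y \<and> d \<le> card (nbrs E e x)"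
  shows "card S * (2 * d + 1) \<le> 2 * (\<Sum>x\<in>S. card (nbrs E e x \<inter> Y))
    + 2 * (\<Sum>x\<in>S. card (nbrs E e x \<inter> (X - S))) + card S * card S"
proof -
  let ?N = "nbrs E e"
  have fS: "finite S" using assms finite_subset by blast
  have "d \<le> card (?N x \<inter> Y) + card (?N x \<inter> (X - S)) + card (?N x \<inter> S)" if "x \<in> S" for x
  proof -
    have "?N x = (?N x \<inter> Y) \<union> ((?N x \<inter> (X - S)) \<union> (?N x \<inter> S))" using nb[OF that] assms(4) by blast
    then have "card (?N x) \<le> card (?N x \<inter> Y) + card ((?N x \<inter> (X - S)) \<union> (?N x \<inter> S))"
      by (metis card_Un_le)
    also have "\<dots> \<le> card (?N x \<inter> Y) + (card (?N x \<inter> (X - S)) + card (?N x \<inter> S))"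
      using card_Un_le add_left_mono by blast
    finally show ?thesis using nb[OF that] by linarith
  qed
  then have "card S * d \<le> (\<Sum>x\<in>S. card (?N x \<inter> Y) + card (?N x \<inter> (X - S)) + card (?N x \<inter> S))"
    using sum_bounded_below[of S d] by fastforce
  also have "\<dots> = (\<Sum>x\<in>S. card (?N x \<inter> Y)) + (\<Sum>x\<in>S. card (?N x \<inter> (X - S))) + (\<Sum>x\<in>S. card (?N x \<inter> S))"
    by (simp add: sum.distrib)
  finally have "card S * d \<le> \<dots>" .
  moreover have "2 * (\<Sum>x\<in>S. card (?N x \<inter> S)) + card S \<le> card S * card S"
    using asym_arc_count[OF fS, of ?N] nbrs_asym by blast
  ultimately show ?thesis by (simp add: algebra_simps)
qed

text \<open>With \<open>t\<close> ends, rotations bound the neighbours in \<open>Y\<close> by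
  \<open>t\<close> and those in \<open>X - S\<close> number at most \<open>card X - t\<close>.
  Counting then gives 2d + 1 <= t + 2|X|, which makes \<open>t\<close> as large as possible. For odd
  \<open>k\<close> the start also lies in \<open>X\<close> but cannot be an end.\<close>

lemma ends_eq:
  assumes p: "antipath E p" and k: "length p = k" "2 \<le> k" and d: "3 * k \<le> 4 * d + 3"
    and closed: "\<And>u. u \<in> ends E p \<Longrightarrow> nbrs E (snd (last p)) u \<subseteq> fst ` set p"
    and nonadj: "odd k \<Longrightarrow> fst (hd p) \<notin> nbrs E (snd (last p)) (fst (last p))"
  shows "ends E p = layer p (snd (last p)) - (if odd k then {fst (hd p)} else {})"
proof -
  define e where "e = snd (last p)"
  define X where "X = layer p e"
  define Y where "Y = layer p (\<not> e)"
  define S where "S = ends E p"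
  define t where "t = card S"
  let ?N = "nbrs E e"
  have ne: "p \<noteq> []" using p by (simp add: antipath_def)
  have fin: "finite X" "finite Y" by (simp_all add: X_def Y_def finite_layer)
  have XY: "X \<inter> Y = {}" using layers_disjoint[OF p] by (simp add: X_def Y_def)
  have SX: "S \<subseteq> X" using ends_subset[OF p] by (simp add: S_def X_def e_def)
  have fS: "finite S" using SX fin finite_subset by blast
  have x0: "fst (last p) \<in> S"
    unfolding S_def ends_def using p by (auto intro!: exI[of _ p])
  then have t0: "0 < t" using fS by (auto simp: t_def card_gt_0_iff)
  have nb: "?N x \<subseteq> X \<union> Y \<and> d \<le> card (?N x)" if x: "x \<in> S" for x
  proof
    show "?N x \<subseteq> X \<union> Y"
      using closed x fst_image_eq_layers[of p e] by (simp add: S_def X_def Y_def e_def)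
    obtain q where q: "antipath E q" "set q = set p" "last q = (x, e)"
      using x by (auto simp: S_def ends_def e_def)
    have "length q = k"
      using k q p by (metis antipath_distinct distinct_card)
    then show "d \<le> card (?N x)" using last_degree[OF q(1)] q(3) k by simp
  qed
  have "(\<Sum>x\<in>S. card (?N x \<inter> Y)) \<le> t * t"
    using sum_bounded_above[of S "\<lambda>x. card (?N x \<inter> Y)" t] card_nbrs_le_ends[OF p]
    by (simp add: S_def t_def Y_def e_def)
  then have main: "t * (2 * d + 1) \<le> 3 * (t * t) + 2 * (\<Sum>x\<in>S. card (?N x \<inter> (X - S)))"
    using degree_count[OF fin XY SX nb] by (simp add: t_def)
  have le: "card (?N x \<inter> (X - S)) \<le> card X - t" for x
  proof -
    have "card (?N x \<inter> (X - S)) \<le> card (X - S)" using fin by (auto intro: card_mono)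
    then show ?thesis using card_Diff_subset[OF fS SX] by (simp add: t_def)
  qed
  have tX: "t \<le> card X" using SX fin by (simp add: t_def card_mono)
  have tX': "t * (card X - t) + t * t = t * card X"
    using tX by (metis add_mult_distrib2 le_add_diff_inverse2)
  show ?thesis
  proof (cases "odd k")
    case False
    have "(\<Sum>x\<in>S. card (?N x \<inter> (X - S))) \<le> t * (card X - t)"
      using sum_bounded_above[of S "\<lambda>x. card (?N x \<inter> (X - S))"] le by (simp add: t_def)
    then have "t * (2 * d + 1) \<le> t * (t + 2 * card X)"
      using main tX' by (simp add: algebra_simps)
    then have "2 * d + 1 \<le> t + 2 * card X" using t0 mult_le_cancel1 by blast
    moreover have "card X = k div 2"
      using card_layer_last[OF p] k False by (simp add: X_def e_def)
    \<comment> \<open>From 4d + 3 >= 3k and |X| = k/2 one gets 2t >= k - 1, and parity raises this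
      to 2t >= k.\<close>
    ultimately have "card X \<le> t" using d False by presburger
    then have "S = X" using SX fin by (simp add: card_seteq t_def)
    then show ?thesis using False by (simp add: S_def X_def e_def)
  next
    case True
    have he: "snd (hd p) = e" using antipath_last_type[OF p] True k by (auto simp: e_def)
    then have wX: "fst (hd p) \<in> X" using hd_in_set[OF ne] by (simp add: X_def layer_def flip: he)
    have wS: "fst (hd p) \<notin> S"
    proof
      assume "fst (hd p) \<in> S"
      then obtain q where q: "antipath E q" "set q = set p" "hd q = hd p" "last q = (fst (hd p), e)"
        by (auto simp: S_def ends_def e_def)
      have "length q = k"
        using k q p by (metis antipath_distinct distinct_card)
      moreover have "hd q = last q" using q he by (simp add: prod_eq_iff)
      moreover have "distinct q" using q antipath_distinct by blast
      ultimately show False using k(2)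
        by (cases q) (auto split: if_splits)
    qed
    \<comment> \<open>The weak inequality would only give t >= |X| - 2. The end of \<open>p\<close>
      misses the start, which lies in \<open>X - S\<close>; this strictness yields t >= |X| -
      1.\<close>
    have "(\<Sum>x\<in>S. card (?N x \<inter> (X - S))) < (\<Sum>x\<in>S. card X - t)"
    proof (rule sum_strict_mono_ex1[OF fS])
      have "?N (fst (last p)) \<inter> (X - S) \<subset> X - S"
        using nonadj True wX wS by (auto simp: e_def)
      then have "card (?N (fst (last p)) \<inter> (X - S)) < card (X - S)"
        using fin by (simp add: psubset_card_mono)
      then show "\<exists>x\<in>S. card (?N x \<inter> (X - S)) < card X - t"
        using x0 card_Diff_subset[OF fS SX] by (auto simp: t_def)
    qed (use le in blast)
    then have "(\<Sum>x\<in>S. card (?N x \<inter> (X - S))) < t * (card X - t)"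
      by (simp add: t_def)
    then have "t * (2 * d + 1) < t * (t + 2 * card X)"
      using main tX' by (simp add: algebra_simps)
    then have "2 * d + 1 < t + 2 * card X" using mult_less_cancel1 by blast
    moreover have cX: "card X = (k + 1) div 2"
      using card_layer_last[OF p] k by (simp add: X_def e_def)
    ultimately have "card X - 1 \<le> t" using d True by presburger
    moreover have "S \<subseteq> X - {fst (hd p)}" using SX wS by blast
    moreover have "card (X - {fst (hd p)}) = card X - 1" using wX fin by simp
    ultimately have "S = X - {fst (hd p)}" using fin by (intro card_seteq) (auto simp: t_def)
    then show ?thesis using True by (simp add: S_def X_def e_def)
  qed
qed

text \<open>The new path need not contain the old one; only the type of the start is kept, which
  distinguishes the two antipaths of even length.\<close>

lemma antipath_extend:
  assumes p: "antipath E p" and k: "length p = k" "2 \<le> k"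
    and d: "3 * k \<le> 4 * d + 3" "2 \<le> d"
  shows "\<exists>q. antipath E q \<and> length q = Suc k \<and> snd (hd q) = snd (hd p)"
proof (rule ccontr)
  assume noext: "\<not> ?thesis"
  define e where "e = snd (last p)"
  define X where "X = layer p e"
  define Y where "Y = layer p (\<not> e)"
  let ?N = "nbrs E e"
  have ne: "p \<noteq> []" using p by (simp add: antipath_def)
  have fin: "finite X" "finite Y" by (simp_all add: X_def Y_def finite_layer)
  have XY: "X \<inter> Y = {}" using layers_disjoint[OF p] by (simp add: X_def Y_def)
  have pXY: "fst ` set p = X \<union> Y" using fst_image_eq_layers[of p e] by (simp add: X_def Y_def)
  have cX: "card X = (k + 1) div 2" and cY: "card Y = k div 2"
    using card_layer_last[OF p] k by (simp_all add: X_def Y_def e_def)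
  have kXY: "k = card X + card Y" "card Y \<le> card X" "card X \<le> card Y + 1"
    and kodd: "odd k \<Longrightarrow> card X = card Y + 1" and keven: "even k \<Longrightarrow> card X = card Y"
    unfolding cX cY by presburger+
  have he: "snd (hd p) = (if odd k then e else \<not> e)"
    using antipath_last_type[OF p] k by (auto simp: e_def)
  have len: "length q = k" if "antipath E q" "set q = set p" for q
    using that k p by (metis antipath_distinct distinct_card)
  have lt: "snd (last q) = e" if "antipath E q" "set q = set p" "snd (hd q) = snd (hd p)" for q
    using antipath_last_type[OF that(1)] len[OF that(1,2)] that(3) he by auto
  have closed: "nbrs E e u \<subseteq> fst ` set p"
    if q: "antipath E q" "set q = set p" "snd (hd q) = snd (hd p)" "last q = (u, e)" for q u
  proof
    fix v assume v: "v \<in> nbrs E e u"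
    show "v \<in> fst ` set p"
    proof (rule ccontr)
      assume "v \<notin> fst ` set p"
      then have "antipath E (q @ [(v, \<not> e)])"
        using q v by (intro antipath_snoc) (auto simp: split_adj_pair)
      moreover have "hd (q @ [(v, \<not> e)]) = hd q" using q(1) by (simp add: antipath_def)
      ultimately show False using noext len[OF q(1,2)] q(3)
        by (metis length_append_singleton)
    qed
  qed
  have all_ends: "\<exists>q. antipath E q \<and> set q = set p \<and> snd (hd q) = snd (hd p) \<and> last q = (u, e)"
    if u: "u \<in> X" for u
  proof -
    \<comment> \<open>For odd \<open>k\<close> both path ends have type \<open>e\<close>. By
      asymmetry the start cannot be a neighbour of the end both in \<open>p\<close> and in its
      reversal, so one of the two satisfies the nonadjacency condition of
      \<open>ends_eq\<close>.\<close>
    obtain r where r: "antipath E r" "set r = set p" "snd (hd r) = snd (hd p)"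
      "odd k \<Longrightarrow> fst (hd r) \<notin> nbrs E e (fst (last r))"
    proof (cases "odd k \<and> fst (hd p) \<in> nbrs E e (fst (last p))")
      case False
      then show ?thesis using that[of p] p by auto
    next
      case True
      have "snd (hd (rev p)) = snd (hd p)" using True he ne by (simp add: hd_rev e_def)
      moreover have "fst (hd (rev p)) \<notin> nbrs E e (fst (last (rev p)))"
        using True nbrs_asym ne by (simp add: hd_rev last_rev)
      ultimately show ?thesis using that[of "rev p"] antipath_rev[OF p] by simp
    qed
    have lr: "snd (last r) = e" using lt r by blast
    have "ends E r = layer r (snd (last r)) - (if odd k then {fst (hd r)} else {})"
    proof (rule ends_eq[OF r(1) len[OF r(1,2)] k(2) d(1)])
      fix u assume "u \<in> ends E r"
      then obtain q where "antipath E q" "set q = set r" "hd q = hd r" "last q = (u, e)"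
        by (auto simp: ends_def lr)
      then show "nbrs E (snd (last r)) u \<subseteq> fst ` set r"
        using closed[of q u] r lr by simp
    qed (use r lr in simp)
    moreover have "layer r (snd (last r)) = X" by (simp add: lr X_def layer_def r(2))
    ultimately have "u \<in> ends E r \<or> odd k \<and> u = fst (hd r)" using u by (auto split: if_splits)
    then show ?thesis
    proof
      assume "u \<in> ends E r"
      then show ?thesis using r(2,3) lr by (auto simp: ends_def)
    next
      \<comment> \<open>The one vertex of \<open>X\<close> that \<open>ends_eq\<close> leaves out is
        the end of the reversed path.\<close>
      assume a: "odd k \<and> u = fst (hd r)"
      have rn: "r \<noteq> []" using r(1) by (simp add: antipath_def)
      have "snd (hd r) = e" using a he r(3) by simp
      then have "last (rev r) = (u, e)" using a rn by (simp add: last_rev prod_eq_iff)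
      moreover have "snd (hd (rev r)) = snd (hd p)" using lr a he rn by (simp add: hd_rev)
      ultimately show ?thesis using antipath_rev[OF r(1)] r(2) by (intro exI[of _ "rev r"]) simp
    qed
  qed
  have nb: "?N x \<subseteq> X \<union> Y \<and> d \<le> card (?N x)" if x: "x \<in> X" for x
  proof -
    obtain q where q: "antipath E q" "set q = set p" "snd (hd q) = snd (hd p)" "last q = (x, e)"
      using all_ends[OF x] by blast
    show ?thesis using closed[OF q] pXY last_degree[OF q(1)] len[OF q(1,2)] q(4) k by simp
  qed
  have X0: "0 < card X" using cX k by simp
  \<comment> \<open>The count is repeated with \<open>S = X\<close>. A single missing pair makes it
    strict, 2d + 1 < 2|Y| + |X|, contradicting 3k <= 4d + 3.\<close>
  have complete: "Y \<subseteq> ?N x" if x: "x \<in> X" for x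
  proof (rule ccontr)
    assume "\<not> Y \<subseteq> ?N x"
    then have "card (?N x \<inter> Y) < card Y" using fin by (intro psubset_card_mono) auto
    then have "(\<Sum>x\<in>X. card (?N x \<inter> Y)) < (\<Sum>x\<in>X. card Y)"
      using fin x by (intro sum_strict_mono_ex1) (auto intro!: card_mono)
    then have "card X * (2 * d + 1) < card X * (2 * card Y + card X)"
      using degree_count[OF fin XY subset_refl nb] by (simp add: algebra_simps)
    then have "2 * d + 1 < 2 * card Y + card X" using mult_less_cancel1 by blast
    then show False using d(1) kXY by linarith
  qed
  \<comment> \<open>For \<open>k = 2\<close> this is the bound \<open>2 \<le> d\<close>; for larger
    \<open>k\<close> it follows from 3k <= 4d + 3.\<close>
  have dY: "card Y < d" using d kXY by linarith
  obtain x where x: "x \<in> X" using X0 by (metis card_gt_0_iff ex_in_conv)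
  have "\<not> ?N x \<subseteq> Y" using nb[OF x] dY fin card_mono[of Y "?N x"] by linarith
  then obtain x' where x': "x' \<in> X" "x' \<in> ?N x" using nb[OF x] by blast
  have xx': "x \<noteq> x'" using nbrs_asym x'(2) by blast
  have x_x': "x \<in> nbrs E (\<not> e) x'" using x'(2) by (simp add: nbrs_flip)
  \<comment> \<open>In the opposite direction \<open>x'\<close> has at least \<open>d\<close>
    neighbours. None lies in \<open>Y\<close>, by completeness and asymmetry, and
    \<open>X - {x'}\<close> has at most |Y| < d elements, so some neighbour \<open>v\<close> lies
    outside the old path.\<close>
  have "nbrs E (\<not> e) x' \<inter> Y = {}"
    using complete[OF x'(1)] by (auto simp: nbrs_flip) (meson nbrs_asym subsetD)
  moreover have "x' \<notin> nbrs E (\<not> e) x'" using nbrs_asym by blast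
  moreover have "\<not> nbrs E (\<not> e) x' \<subseteq> X - {x'}"
  proof
    assume "nbrs E (\<not> e) x' \<subseteq> X - {x'}"
    then have "card (nbrs E (\<not> e) x') \<le> card X - 1"
      using fin x'(1) card_mono[of "X - {x'}"] by simp
    then show False using min_degree[OF x_x'] dY kXY by linarith
  qed
  ultimately obtain v where v: "v \<in> nbrs E (\<not> e) x'" "v \<notin> X" "v \<notin> Y" by blast
  have vx': "x' \<in> ?N v" using v(1) by (simp add: nbrs_flip)
  have c2: "card (X - {x, x'}) = card X - 2"
    using x x'(1) xx' fin by (simp add: card_Diff_subset)
  \<comment> \<open>Here \<open>x'\<close> takes the type opposite to its old one, linking the exit
    \<open>v\<close> to \<open>x\<close>; the zigzag through \<open>Y\<close> and the rest of
    \<open>X\<close> continues from \<open>x\<close>.\<close>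
  have base: "antipath E [(v, e), (x', \<not> e), (x, e)]"
    using vx' x_x' xx' v x x' by (auto simp: antipath_def split_adj_pair)
  show False
  proof (cases "odd k")
    case True
    \<comment> \<open>The result has 3 + 2(|X| - 2) + 1 = 2|X| = k + 1 vertices, and its start has
      type \<open>e\<close>, as for \<open>p\<close>.\<close>
    have "\<exists>q. antipath E q \<and> hd q = hd [(v, e), (x', \<not> e), (x, e)] \<and>
      length q = length [(v, e), (x', \<not> e), (x, e)] + 2 * card (X - {x, x'}) + 1"
    proof (rule antipath_zigzag[OF base])
      show "card (X - {x, x'}) < card Y" using c2 kXY kodd[OF True] k by linarith
      show "\<And>z. z \<in> insert x (X - {x, x'}) \<Longrightarrow> Y \<subseteq> nbrs E e z" using complete x by blast
    qed (use fin XY v x x' in auto)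
    then obtain q where q: "antipath E q" "hd q = (v, e)" "length q = 3 + 2 * (card X - 2) + 1"
      by (auto simp: c2)
    moreover have "length q = Suc k" using q(3) kXY(1) kodd[OF True] k by linarith
    ultimately show False using noext he True by (metis snd_conv)
  next
    case False
    have kE: "card X = card Y" by (rule keven) (use False in simp)
    \<comment> \<open>For even \<open>k\<close> the start must have type \<open>\<not> e\<close>, so
      one more vertex \<open>z\<close> is put before \<open>v\<close>. It may lie in
      \<open>Y\<close>, which is why the zigzag uses \<open>Y - {z}\<close>.\<close>
    have "\<not> ?N v \<subseteq> X"
      using min_degree[OF vx'] dY kE fin card_mono[of X "?N v"] by linarith
    then obtain z where z: "z \<in> ?N v" "z \<notin> X" by blast
    have zv: "z \<noteq> v" using z(1) nbrs_asym by blast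
    let ?b = "[(z, \<not> e), (v, e), (x', \<not> e), (x, e)]"
    have "v \<in> nbrs E (\<not> e) z" using z(1) by (simp add: nbrs_flip)
    then have base': "antipath E ?b"
      using base zv z x x' by (auto simp: antipath_def split_adj_pair)
    have X2: "2 \<le> card X"
      using card_mono[of X "{x, x'}"] x x' xx' fin by simp
    have "\<exists>q. antipath E q \<and> hd q = hd ?b \<and> length q = length ?b + 2 * card (X - {x, x'}) + 1"
    proof (rule antipath_zigzag[OF base'])
      have "card Y - 1 \<le> card (Y - {z})" using fin by (simp add: card_Diff_singleton_if)
      then show "card (X - {x, x'}) < card (Y - {z})" using c2 kE X2 by linarith
      show "\<And>u. u \<in> insert x (X - {x, x'}) \<Longrightarrow> Y - {z} \<subseteq> nbrs E e u" using complete x by blast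
    qed (use fin XY v x x' z in auto)
    then obtain q where q: "antipath E q" "hd q = (z, \<not> e)" "length q = 4 + 2 * (card X - 2) + 1"
      by (auto simp: c2)
    moreover have "length q = Suc k" using q(3) kXY(1) kE X2 by linarith
    ultimately show False using noext he False by (metis snd_conv)
  qed
qed

text \<open>Induction from a single arc. Here \<open>k\<close> counts arcs: reaching
  \<open>Suc k\<close> arcs extends a path on \<open>Suc k\<close> vertices, so the degree condition
  of \<open>antipath_extend\<close> is the one assumed for the target.\<close>

lemma antipath_exists:
  assumes "E \<noteq> {}" "2 \<le> d" "1 \<le> k" "3 * k \<le> 4 * d + 3"
  shows "\<exists>p. antipath E p \<and> length p = Suc k \<and> snd (hd p) = c"
  using assms(3,4)
proof (induction k rule: nat_induct_at_least)
  case base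
  obtain u v where uv: "(u, v) \<in> E" using assms(1) by auto
  then have "u \<noteq> v" using asym by blast
  then show ?case using arc_antipath[OF uv] by (simp add: numeral_2_eq_2)
next
  case (Suc k)
  then obtain p where "antipath E p" "length p = Suc k" "snd (hd p) = c" by auto
  then show ?case using antipath_extend[of p "Suc k"] Suc assms(2) by auto
qed

end

section \<open>From edge density to minimum degree\<close>

lemma antipath_mono:
  assumes "antipath F p" "F \<subseteq> E"
  shows "antipath E p"
proof -
  have "split_adj E x y" if "split_adj F x y" for x y
    using that assms(2) by (auto simp: split_adj_def nbrs_def split: if_splits)
  then show ?thesis
    using assms(1) unfolding antipath_def by (metis successively_mono)
qed

text \<open>The density \<open>|F| / (|Domain F| + |Range F|)\<close> does not decrease when all arcs leaving (or
  all arcs entering) a vertex of small degree are removed.\<close>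

lemma dense_subset:
  fixes m :: nat
  assumes "finite E" "m * (card (Domain E) + card (Range E)) < 4 * card E"
  shows "\<exists>F\<subseteq>E. F \<noteq> {} \<and> (\<forall>b u v. v \<in> nbrs F b u \<longrightarrow> m < 4 * card (nbrs F b u))"
  using assms
proof (induction E rule: finite_psubset_induct)
  case (psubset E)
  show ?case
  proof (cases "\<forall>b u v. v \<in> nbrs E b u \<longrightarrow> m < 4 * card (nbrs E b u)")
    case True
    moreover have "E \<noteq> {}" using psubset.prems by auto
    ultimately show ?thesis by blast
  next
    case False
    then obtain b u v where uv: "v \<in> nbrs E b u" and small: "4 * card (nbrs E b u) \<le> m"
      by (auto simp: not_less)
    define A where "A = (if b then Pair u else (\<lambda>w. (w, u))) ` nbrs E b u"
    have AE: "A \<subseteq> E" by (auto simp: A_def nbrs_def)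
    have cA: "card A = card (nbrs E b u)"
      unfolding A_def by (intro card_image) (auto simp: inj_on_def)
    have A0: "A \<noteq> {}" using uv by (auto simp: A_def)
    have fA: "finite A" using AE psubset.hyps finite_subset by blast
    have fin: "finite (Domain E)" "finite (Range E)"
      using psubset.hyps by (auto intro: finite_Domain finite_Range)
    \<comment> \<open>Deleting \<open>A\<close> removes \<open>u\<close> from the domain or from the
      range. The left side of the density inequality thus drops by at least \<open>m\<close>, the
      right side by 4|A| <= m.\<close>
    have "card (Domain (E - A)) + card (Range (E - A)) + 1 \<le> card (Domain E) + card (Range E)"
    proof (cases b)
      case True
      have "Domain (E - A) \<subset> Domain E" "Range (E - A) \<subseteq> Range E"
        using True uv by (auto simp: A_def nbrs_def)
      then have "card (Domain (E - A)) < card (Domain E)" "card (Range (E - A)) \<le> card (Range E)"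
        using fin by (simp_all add: psubset_card_mono card_mono)
      then show ?thesis by linarith
    next
      case False
      have "Range (E - A) \<subset> Range E" "Domain (E - A) \<subseteq> Domain E"
        using False uv by (auto simp: A_def nbrs_def)
      then have "card (Range (E - A)) < card (Range E)" "card (Domain (E - A)) \<le> card (Domain E)"
        using fin by (simp_all add: psubset_card_mono card_mono)
      then show ?thesis by linarith
    qed
    then have "m * (card (Domain (E - A)) + card (Range (E - A)) + 1) \<le> m * (card (Domain E) + card (Range E))"
      by (rule mult_le_mono2)
    then have "m * (card (Domain (E - A)) + card (Range (E - A))) + m < 4 * card E"
      using psubset.prems by simp
    moreover have "card E = card (E - A) + card A"
      using card_Diff_subset[OF fA AE] card_mono[OF psubset.hyps(1) AE] by simp
    ultimately have "m * (card (Domain (E - A)) + card (Range (E - A))) < 4 * card (E - A)"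
      using small cA by linarith
    moreover have "E - A \<subset> E" using A0 AE by blast
    ultimately show ?thesis using psubset.IH[of "E - A"] by (meson order_trans psubset_imp_subset)
  qed
qed

text \<open>Lengths 1 and 2 are treated directly, since the degree obtained for them would be below
  the 2 that extension requires.\<close>

lemma antipath_in_dense_arcs:
  assumes E: "finite E" "\<And>u v. (u, v) \<in> E \<Longrightarrow> (v, u) \<notin> E"
    and V: "finite V" "E \<subseteq> V \<times> V"
    and k: "1 \<le> k" "E \<noteq> {}" and dense: "3 * k * card V < 2 * card E + 4 * card V"
  shows "\<exists>p. antipath E p \<and> length p = Suc k \<and> snd (hd p) = c"
proof -
  consider "k = 1" | "k = 2" | "3 \<le> k" using k by linarith
  then show ?thesis
  proof cases
    case 1
    obtain u v where uv: "(u, v) \<in> E" using k(2) by auto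
    then have "u \<noteq> v" using E(2) by blast
    then show ?thesis using arc_antipath[OF uv] 1 by (simp add: numeral_2_eq_2)
  next
    case 2
    then have "card V < card E" using dense by simp
    \<comment> \<open>Pigeonhole: with more arcs than vertices, two arcs share a head and also two
      share a tail; \<open>c\<close> selects which is wanted.\<close>
    moreover have "(if c then snd else fst) ` E \<subseteq> V" using V(2) by auto
    ultimately have "\<not> inj_on (if c then snd else fst) E"
      using card_inj_on_le[OF _ _ V(1)] by fastforce
    then obtain x y where xy: "x \<in> E" "y \<in> E" "x \<noteq> y" "(if c then snd x = snd y else fst x = fst y)"
      by (auto simp: inj_on_def split: if_splits)
    show ?thesis
    proof (cases c)
      case True
      then obtain u w v where "(u, v) \<in> E" "(w, v) \<in> E" "u \<noteq> w"
        using xy by (metis prod.collapse)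
      then show ?thesis using E(2) 2 True
        by (intro exI[of _ "[(u, True), (v, False), (w, True)]"])
          (auto simp: antipath_def split_adj_def nbrs_def)
    next
      case False
      then obtain u w v where "(v, u) \<in> E" "(v, w) \<in> E" "u \<noteq> w"
        using xy by (metis prod.collapse)
      then show ?thesis using E(2) 2 False
        by (intro exI[of _ "[(u, False), (v, True), (w, False)]"])
          (auto simp: antipath_def split_adj_def nbrs_def)
    qed
  next
    case 3
    define m where "m = 3 * k - 4"
    have "card (Domain E) \<le> card V" "card (Range E) \<le> card V"
      using V by (auto intro!: card_mono)
    then have "m * (card (Domain E) + card (Range E)) \<le> m * (2 * card V)"
      by (intro mult_le_mono2) linarith
    moreover have "m * (2 * card V) + 8 * card V = 2 * (3 * k * card V)"
    proof -
      have "m * (2 * card V) + 8 * card V = (m + 4) * (2 * card V)" by (simp add: algebra_simps)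
      also have "m + 4 = 3 * k" using 3 by (simp add: m_def)
      finally show ?thesis by simp
    qed
    ultimately have "m * (card (Domain E) + card (Range E)) < 4 * card E"
      using dense by linarith
    then obtain F where F: "F \<subseteq> E" "F \<noteq> {}"
      and deg: "\<forall>b u v. v \<in> nbrs F b u \<longrightarrow> m < 4 * card (nbrs F b u)"
      using dense_subset[OF E(1), of m] by metis
    \<comment> \<open>The least integer above m/4: it satisfies 4d >= m + 1 = 3k - 3, and
      \<open>2 \<le> d\<close> because \<open>m\<close> is at least 5.\<close>
    define d where "d = m div 4 + 1"
    interpret dense_arcs F d
    proof
      show "(v, u) \<notin> F" if "(u, v) \<in> F" for u v using that E(2) F(1) by blast
      show "d \<le> card (nbrs F b u)" if "v \<in> nbrs F b u" for v b u
        using deg[rule_format, OF that] by (simp add: d_def)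
    qed
    have "2 \<le> d" "3 * k \<le> 4 * d + 3" using 3 by (auto simp: d_def m_def)
    then obtain p where "antipath F p" "length p = Suc k" "snd (hd p) = c"
      using antipath_exists[OF F(2)] k(1) by blast
    then show ?thesis using antipath_mono[OF _ F(1)] by blast
  qed
qed

section \<open>Transfer to digraphs and subgraph copies\<close>

text \<open>Every vertex is a source or a sink, so directions alternate and one Boolean
  \<open>c\<close>, telling whether the first arc points forward, determines them all.\<close>

lemma antidirected_path_arcs:
  assumes "antidirected_path k P"
  obtains p c where "distinct p" "length p = k + 1" "pverts P = set p"
    and "\<And>x y. (x, y) \<in> parcs P \<Longrightarrow> \<exists>i<k. (x, y) = (if even i = c then (p ! i, p ! (i + 1)) else (p ! (i + 1), p ! i))"
proof -
  interpret P: oriented_graph P using assms by (simp add: antidirected_path_def)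
  obtain p where p: "distinct p" "length p = k + 1" "pverts P = set p"
    and sym: "parcs (mk_symmetric (with_proj P)) = (\<Union>i<k. {(p ! i, p ! (i + 1)), (p ! (i + 1), p ! i)})"
    and deg: "\<And>v. v \<in> pverts P \<Longrightarrow> out_degree (with_proj P) v = 0 \<or> in_degree (with_proj P) v = 0"
    using assms by (auto simp: antidirected_path_def)
  have either: "(p ! i, p ! (i + 1)) \<in> parcs P \<or> (p ! (i + 1), p ! i) \<in> parcs P" if "i < k" for i
  proof -
    have "(p ! i, p ! (i + 1)) \<in> parcs (mk_symmetric (with_proj P))" using sym that by blast
    then show ?thesis by (auto simp: parcs_mk_symmetric)
  qed
  have through: "(y, z) \<notin> parcs P" if "(x, y) \<in> parcs P" for x y z
  proof
    assume yz: "(y, z) \<in> parcs P"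
    have "y \<in> pverts P" using that P.in_arcsD2 by blast
    moreover have "(x, y) \<in> in_arcs (with_proj P) y" "(y, z) \<in> out_arcs (with_proj P) y"
      using that yz by (auto simp: in_arcs_def out_arcs_def)
    moreover have "finite (in_arcs (with_proj P) y)" "finite (out_arcs (with_proj P) y)"
      using P.pair_finite_arcs by (auto simp: in_arcs_def out_arcs_def)
    ultimately show False
      using deg[of y] unfolding in_degree_def out_degree_def by (metis card_0_eq empty_iff)
  qed
  define c where "c \<longleftrightarrow> (p ! 0, p ! 1) \<in> parcs P"
  have dir: "(if even i = c then (p ! i, p ! (i + 1)) else (p ! (i + 1), p ! i)) \<in> parcs P" if "i < k" for i
    using that
  proof (induction i)
    case 0
    then show ?case using either[of 0] by (auto simp: c_def)
  next
    case (Suc i)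
    then show ?case using either[of "Suc i"] through by (auto split: if_splits)
  qed
  show thesis
  proof
    fix x y assume xy: "(x, y) \<in> parcs P"
    then have "(x, y) \<in> parcs (mk_symmetric (with_proj P))" by (force simp: parcs_mk_symmetric)
    then obtain i where i: "i < k" "(x, y) = (p ! i, p ! (i + 1)) \<or> (x, y) = (p ! (i + 1), p ! i)"
      using sym by auto
    then show "\<exists>i<k. (x, y) = (if even i = c then (p ! i, p ! (i + 1)) else (p ! (i + 1), p ! i))"
      using dir[OF i(1)] xy P.no_antiparallel_arcs by (intro exI[of _ i]) (auto split: if_splits)
  qed (use p in auto)
qed

text \<open>The type of \<open>q ! j\<close> is \<open>True\<close> exactly when
  \<open>even j = c\<close>, and such vertices are tails. This is the parity pattern of
  \<open>antidirected_path_arcs\<close>.\<close>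

lemma antipath_arcs:
  assumes "antipath E q" "snd (hd q) = c" "Suc i < length q"
  shows "(if even i = c then (fst (q ! i), fst (q ! (i + 1))) else (fst (q ! (i + 1)), fst (q ! i))) \<in> E"
proof -
  have adj: "split_adj E (q ! j) (q ! Suc j)" if "Suc j < length q" for j
    using assms(1) that by (auto simp: antipath_def successively_conv_nth)
  have "snd (q ! j) = (even j = c)" if "j < length q" for j
    using that
  proof (induction j)
    case 0
    then show ?case using assms(1,2) by (auto simp: antipath_def hd_conv_nth)
  next
    case (Suc j)
    then show ?case using adj[of j] by (auto simp: split_adj_def)
  qed
  then have "snd (q ! i) = (even i = c)" using assms(3) by simp
  then show ?thesis using adj[OF assms(3)] by (auto simp: split_adj_def nbrs_def split: if_splits)
qed

theorem theorem4:
  fixes k :: nat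
    and D :: "'a pair_pre_digraph"
    and P :: "'b pair_pre_digraph"
  assumes "k \<ge> 1"
    and "oriented_graph D"
    and "real (card (parcs D)) > (3 * real k - 4) * real (card (pverts D)) / 2"
    and "k = 1 \<longrightarrow> parcs D \<noteq> {}"
    and "antidirected_path k P"
  shows "contains_copy D P"
proof -
  interpret D: oriented_graph D by fact
  interpret P: oriented_graph P using assms(5) by (simp add: antidirected_path_def)
  obtain p c where p: "distinct p" "length p = k + 1" "pverts P = set p"
    and Parcs: "\<And>x y. (x, y) \<in> parcs P \<Longrightarrow> \<exists>i<k. (x, y) = (if even i = c then (p ! i, p ! (i + 1)) else (p ! (i + 1), p ! i))"
    using antidirected_path_arcs[OF assms(5)] by metis
  have dense: "3 * k * card (pverts D) < 2 * card (parcs D) + 4 * card (pverts D)"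
  proof -
    have "real (3 * k * card (pverts D)) < real (2 * card (parcs D) + 4 * card (pverts D))"
      using assms(3) by (simp add: field_simps)
    then show ?thesis by (simp only: of_nat_less_iff)
  qed
  \<comment> \<open>For \<open>k\<close> at least 2 the factor 3k - 4 is positive and forces an arc;
    for \<open>k = 1\<close> the bound can hold without arcs, and the hypothesis supplies
    one.\<close>
  have ne: "parcs D \<noteq> {}"
  proof
    assume "parcs D = {}"
    then have "2 \<le> k" "3 * k * card (pverts D) < 4 * card (pverts D)" using assms(1,4) dense by auto
    then show False by auto
  qed
  have "parcs D \<subseteq> pverts D \<times> pverts D" using D.in_arcsD1 D.in_arcsD2 by auto
  from antipath_in_dense_arcs[OF D.pair_finite_arcs D.no_antiparallel_arcs D.pair_finite_verts
      this assms(1) ne dense, of c]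
  obtain q where q: "antipath (parcs D) q" "length q = Suc k" "snd (hd q) = c"
    by auto
  have qarcs: "(if even i = c then (fst (q ! i), fst (q ! (i + 1))) else (fst (q ! (i + 1)), fst (q ! i))) \<in> parcs D"
    if "i < k" for i
    using antipath_arcs[OF q(1,3)] q(2) that by simp
  \<comment> \<open>Vertex \<open>i\<close> of \<open>P\<close> goes to vertex \<open>i\<close> of
    \<open>q\<close>; since the start type of \<open>q\<close> is the direction \<open>c\<close> of
    \<open>P\<close>, arcs go to arcs.\<close>
  define f where "f x = the (map_of (zip p (map fst q)) x)" for x
  have f: "f (p ! i) = fst (q ! i)" if "i \<le> k" for i
    using that p q(2) map_of_zip_nth[of p "map fst q" i] by (simp add: f_def)
  have inj: "inj_on f (pverts P)"
  proof (rule inj_onI)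
    fix x y assume xy: "x \<in> pverts P" "y \<in> pverts P" "f x = f y"
    then obtain i j where ij: "i \<le> k" "x = p ! i" "j \<le> k" "y = p ! j"
      using p by (metis in_set_conv_nth Suc_eq_plus1 less_Suc_eq_le)
    then have "map fst q ! i = map fst q ! j" using xy(3) f q(2) by simp
    then have "i = j"
      using ij q(1,2) nth_eq_iff_index_eq[of "map fst q" i j] by (simp add: antipath_def)
    then show "x = y" using ij by simp
  qed
  have arcs: "(f x, f y) \<in> parcs D" if xy: "(x, y) \<in> parcs P" for x y
  proof -
    obtain i where i: "i < k" "(x, y) = (if even i = c then (p ! i, p ! (i + 1)) else (p ! (i + 1), p ! i))"
      using Parcs[OF xy] by blast
    then show ?thesis using qarcs[OF i(1)] f[of i] f[of "i + 1"] by (auto split: if_splits)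
  qed
  have verts: "f x \<in> pverts D" if x: "x \<in> pverts P" for x
  proof -
    obtain i where i: "i \<le> k" "x = p ! i"
      using x p by (metis in_set_conv_nth Suc_eq_plus1 less_Suc_eq_le)
    \<comment> \<open>The index of a path arc at \<open>p ! i\<close>: the following one, or the
      preceding one at the last vertex. Its image in \<open>D\<close> contains
      \<open>f x\<close>.\<close>
    define j where "j = (if i < k then i else i - 1)"
    have "j < k" "i = j \<or> i = j + 1" using i assms(1) by (auto simp: j_def)
    then show ?thesis
      using qarcs[of j] f[OF i(1)] i(2) D.in_arcsD1 D.in_arcsD2 by (auto split: if_splits)
  qed
  define H :: "'a pair_pre_digraph" where "H = \<lparr>pverts = f ` pverts P, parcs = map_prod f f ` parcs P\<rparr>"
  have "subgraph (with_proj H) (with_proj D)"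
    unfolding subgraph_def
  proof (intro conjI)
    show "wf_digraph (with_proj D)" by (rule D.wf_digraph_axioms)
    show "wf_digraph (with_proj H)"
      by unfold_locales (auto simp: H_def dest: P.in_arcsD1 P.in_arcsD2)
  qed (use arcs verts in \<open>auto simp: H_def\<close>)
  moreover have "digraph_iso (with_proj P) (with_proj H)"
    unfolding digraph_iso_def
  proof (intro exI conjI)
    let ?h = "\<lparr>iso_verts = f, iso_arcs = map_prod f f, iso_head = snd, iso_tail = fst\<rparr>"
    have "inj_on (map_prod f f) (parcs P)"
      using map_prod_inj_on[OF inj inj] by (rule inj_on_subset) (auto dest: P.in_arcsD1 P.in_arcsD2)
    then show "pre_digraph.digraph_isomorphism (with_proj P) ?h"
      using inj P.wf_digraph_axioms by (simp add: pre_digraph.digraph_isomorphism_def)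
    show "with_proj H = app_iso ?h (with_proj P)"
      by (simp add: with_proj_def app_iso_def H_def)
  qed
  ultimately show ?thesis unfolding contains_copy_def by blast
qed

end
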